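(* Let $\rho$ be a metric on $V$, and let $$\kappa:=\max_{\mathbf{e}\in E}\frac{1}{Q(\mathbf{e})}\,\mathbb{E}^\gamma\sum_{x,y\in V}1_{\gamma_{xy}}(\mathbf{e})\,\rho(x,y)\,\mu(x)\mu(y).$$ Let $c_{\rm I}$ be the best (smallest) constant such that $$W_{1,\rho}(f\mu,\mu)\le\frac{c_{\rm I}}{2}\sum_{\mathbf{e}\in E}|D_{\mathbf{e}}f|\,Q(\mathbf{e})\qquad\text{for all probability measures }\nu=f\mu\text{ on }V.$$ Then $c_{\rm I}\le\kappa$.
   Context: Setting: $G=(V,E)$ is a finite connected graph with vertex set $V$ and set of oriented edges $E\subset V^2\setminus\{(x,x):x\in V\}$, which is symmetric; $x\sim y$ means $(x,y)\in E$. Jump rates $q(x,y)\ge 0$ are given with $q(x,y)>0$ if and only if $x\sim y$. A probability measure $\mu$ on $V$ satisfies the detailed balance condition $Q(x,y):=\mu(x)q(x,y)=\mu(y)q(y,x)$ for all $(x,y)\in E$. For $\mathbf{e}=(x,y)\in E$ write $Q(\mathbf{e})=Q(x,y)$ and $D_{\mathbf{e}}f=f(y)-f(x)$. $W_{1,\rho}(\nu,\mu)=\inf_\pi\sum_{x,y}\rho(x,y)\pi(x,y)$ over couplings $\pi$ of $(\nu,\mu)$. A path $\gamma_{xy}$ from $x$ to $y$ is a family of edges $\{\mathbf{e}_1,\dots,\mathbf{e}_n\}$ with $\mathbf{e}_k=(x_{k-1},x_k)\in E$, $x_0=x$, $x_n=y$; it has no circle if all $x_0,\dots,x_n$ are different.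 For every $x\ne y$ in $V$, $\gamma_{xy}$ is a given random (possibly deterministic) path without circle from $x$ to $y$; $\gamma_{xx}=\emptyset$. $\mathbb{E}^\gamma$ is the expectation with respect to the random family $\{\gamma_{xy}:x,y\in V\}$, and $1_{\gamma_{xy}}(\mathbf{e})=1$ if $\mathbf{e}\in\gamma_{xy}$ and $0$ otherwise. *)

theory Defs
  imports
    "HOL-Probability.Probability"
    "Graph_Theory.Pair_Digraph"
    "Graph_Theory.Digraph_Component"
begin

definition Q_edge :: "'v pmf \<Rightarrow> ('v \<Rightarrow> 'v \<Rightarrow> real) \<Rightarrow> 'v \<times> 'v \<Rightarrow> real" where
  "Q_edge \<mu> q e = pmf \<mu> (fst e) * q (fst e) (snd e)"

definition D_edge :: "'v \<times> 'v \<Rightarrow> ('v \<Rightarrow> real) \<Rightarrow> real" where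
  "D_edge e f = f (snd e) - f (fst e)"

definition couplings :: "'v pmf \<Rightarrow> 'v pmf \<Rightarrow> ('v \<times> 'v) pmf set" where
  "couplings \<nu> \<mu> = {\<pi>. map_pmf fst \<pi> = \<nu> \<and> map_pmf snd \<pi> = \<mu>}"

(* Meant for \<nu>, \<mu> supported in the finite set V; every coupling then lives on V \<times> V. *)
definition W1 :: "'v set \<Rightarrow> ('v \<Rightarrow> 'v \<Rightarrow> real) \<Rightarrow> 'v pmf \<Rightarrow> 'v pmf \<Rightarrow> real" where
  "W1 V \<rho> \<nu> \<mu> = (INF \<pi>\<in>couplings \<nu> \<mu>. \<Sum>x\<in>V. \<Sum>y\<in>V. \<rho> x y * pmf \<pi> (x, y))"

definition W1_inequality ::
  "'v pair_pre_digraph \<Rightarrow> ('v \<Rightarrow> 'v \<Rightarrow> real) \<Rightarrow> 'v pmf \<Rightarrow> ('v \<Rightarrow> 'v \<Rightarrow> real) \<Rightarrow> real \<Rightarrow> bool" where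
  "W1_inequality G q \<mu> \<rho> c \<longleftrightarrow>
     (\<forall>(\<nu> :: 'v pmf) (f :: 'v \<Rightarrow> real).
        set_pmf \<nu> \<subseteq> pverts G \<longrightarrow>
        (\<forall>x\<in>pverts G. pmf \<nu> x = f x * pmf \<mu> x) \<longrightarrow>
        W1 (pverts G) \<rho> \<nu> \<mu> \<le> c / 2 * (\<Sum>e\<in>parcs G. \<bar>D_edge e f\<bar> * Q_edge \<mu> q e))"

(* The requirement 0 \<le> c only matters if G is a single vertex, where the inequality reads 0 \<le> 0
   and every real c would be admissible. Otherwise some \<nu> \<noteq> \<mu> forces c > 0. *)
definition c_I ::
  "'v pair_pre_digraph \<Rightarrow> ('v \<Rightarrow> 'v \<Rightarrow> real) \<Rightarrow> 'v pmf \<Rightarrow> ('v \<Rightarrow> 'v \<Rightarrow> real) \<Rightarrow> real" where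
  "c_I G q \<mu> \<rho> = (LEAST c. 0 \<le> c \<and> W1_inequality G q \<mu> \<rho> c)"

(* The maximum over an empty edge set (G a single vertex) is read as 0. *)
definition kappa ::
  "'v pair_pre_digraph \<Rightarrow> ('v \<Rightarrow> 'v \<Rightarrow> real) \<Rightarrow> 'v pmf \<Rightarrow> ('v \<Rightarrow> 'v \<Rightarrow> real) \<Rightarrow>
   'w measure \<Rightarrow> ('v \<Rightarrow> 'v \<Rightarrow> 'w \<Rightarrow> ('v \<times> 'v) list) \<Rightarrow> real" where
  "kappa G q \<mu> \<rho> M \<gamma> =
     (if parcs G = {} then 0
      else Max ((\<lambda>e. 1 / Q_edge \<mu> q e *
                  (\<integral>\<omega>. (\<Sum>x\<in>pverts G. \<Sum>y\<in>pverts G.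
                      indicator (set (\<gamma> x y \<omega>)) e * \<rho> x y * pmf \<mu> x * pmf \<mu> y) \<partial>M))
                ` parcs G))"

end

theory Submission
  imports Defs
begin

text \<open>
  The transport cost is bounded by that of one explicit coupling.  If
  \<open>\<nu> = f\<mu>\<close>, moving the mass \<open>\<mu>(x) \<mu>(y) (f(x) - f(y))\<^sup>+\<close> from every \<open>x\<close> to every \<open>y\<close> turns \<open>\<nu>\<close>
  into \<open>\<mu>\<close>, which gives (\<open>W1_le_mean_oscillation\<close>)

  \<open>W\<^sub>1(\<nu>, \<mu>) \<le> 1/2 \<Sum>x,y. \<rho>(x,y) \<mu>(x) \<mu>(y) |f(x) - f(y)|\<close>.

  Along any path \<open>\<gamma>\<close> from \<open>x\<close> to \<open>y\<close> without circle, telescoping gives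
  \<open>|f(x) - f(y)| \<le> \<Sum>e. 1\<^sub>\<gamma>(e) |D\<^sub>e f|\<close> (\<open>abs_diff_le_sum_path\<close>).  Inserting this, taking the
  expectation over the random paths and exchanging the sums, the factor in front of \<open>|D\<^sub>e f|\<close>
  becomes the expected load of the edge \<open>e\<close>, which is at most \<open>\<kappa> Q(e)\<close> by the definition of \<open>\<kappa>\<close>.
  Hence \<open>\<kappa>\<close> is an admissible constant.

  Two points remain.  To recover the load from \<open>\<kappa>\<close> one needs \<open>Q(e) > 0\<close>, which holds because
  detailed balance spreads the support of \<open>\<mu>\<close> over the connected graph
  (\<open>reversible_measure_pos\<close>).  And a least admissible constant must exist for \<open>c\<^sub>I\<close> to lie below
  every admissible one (\<open>c_I_le\<close>).
\<close>

section \<open>Couplings and the transport cost\<close>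
lemma coupling_of_matrix:
  fixes \<nu> \<mu> :: "'v pmf" and p :: "'v \<Rightarrow> 'v \<Rightarrow> real"
  assumes fin: "finite V"
    and supp: "set_pmf \<nu> \<subseteq> V" "set_pmf \<mu> \<subseteq> V"
    and nonneg: "\<And>x y. x \<in> V \<Longrightarrow> y \<in> V \<Longrightarrow> 0 \<le> p x y"
    and rows: "\<And>x. x \<in> V \<Longrightarrow> (\<Sum>y\<in>V. p x y) = pmf \<nu> x"
    and cols: "\<And>y. y \<in> V \<Longrightarrow> (\<Sum>x\<in>V. p x y) = pmf \<mu> y"
  obtains \<pi> where "\<pi> \<in> couplings \<nu> \<mu>"
    and "\<And>x y. x \<in> V \<Longrightarrow> y \<in> V \<Longrightarrow> pmf \<pi> (x, y) = p x y"
proof -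
  define h where "h = (\<lambda>z. if z \<in> V \<times> V then p (fst z) (snd z) else 0)"
  have h_nonneg: "0 \<le> h z" for z
    using nonneg by (auto simp: h_def)
  have "(\<integral>\<^sup>+z. ennreal (h z) \<partial>count_space UNIV) = (\<Sum>z\<in>V \<times> V. ennreal (h z))"
    using fin by (intro nn_integral_count_space') (auto simp: h_def)
  also have "\<dots> = ennreal (\<Sum>z\<in>V \<times> V. h z)"
    using h_nonneg by (intro sum_ennreal) auto
  also have "(\<Sum>z\<in>V \<times> V. h z) = (\<Sum>x\<in>V. \<Sum>y\<in>V. p x y)"
    by (simp add: h_def sum.cartesian_product split_beta)
  also have "\<dots> = 1"
    using sum_pmf_eq_1[OF fin supp(1)] by (simp add: rows)
  finally have total: "(\<integral>\<^sup>+z. ennreal (h z) \<partial>count_space UNIV) = 1"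
    by simp
  define \<pi> where "\<pi> = embed_pmf h"
  have pmf_\<pi>: "pmf \<pi> z = h z" for z
    unfolding \<pi>_def by (rule pmf_embed_pmf[OF h_nonneg total])
  have supp_\<pi>: "set_pmf \<pi> \<subseteq> V \<times> V"
    by (auto simp: set_pmf_eq pmf_\<pi> h_def)
  have "map_pmf fst \<pi> = \<nu>"
  proof (rule pmf_eqI)
    fix x
    have "pmf (map_pmf fst \<pi>) x = measure \<pi> ({x} \<times> V)"
      unfolding pmf_map using supp_\<pi>
      by (intro measure_prob_cong_0) (auto simp: set_pmf_eq)
    also have "{x} \<times> V = Pair x ` V"
      by auto
    also have "measure \<pi> \<dots> = (\<Sum>y\<in>V. h (x, y))"
      using fin by (simp add: measure_measure_pmf_finite pmf_\<pi> sum.reindex inj_on_def)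
    also have "\<dots> = pmf \<nu> x"
      using rows[of x] supp(1) by (cases "x \<in> V") (auto simp: h_def set_pmf_iff)
    finally show "pmf (map_pmf fst \<pi>) x = pmf \<nu> x" .
  qed
  moreover have "map_pmf snd \<pi> = \<mu>"
  proof (rule pmf_eqI)
    fix y
    have "pmf (map_pmf snd \<pi>) y = measure \<pi> (V \<times> {y})"
      unfolding pmf_map using supp_\<pi>
      by (intro measure_prob_cong_0) (auto simp: set_pmf_eq)
    also have "V \<times> {y} = (\<lambda>x. (x, y)) ` V"
      by auto
    also have "measure \<pi> \<dots> = (\<Sum>x\<in>V. h (x, y))"
      using fin by (simp add: measure_measure_pmf_finite pmf_\<pi> sum.reindex inj_on_def)
    also have "\<dots> = pmf \<mu> y"
      using cols[of y] supp(2) by (cases "y \<in> V") (auto simp: h_def set_pmf_iff)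
    finally show "pmf (map_pmf snd \<pi>) y = pmf \<mu> y" .
  qed
  ultimately show thesis
    by (intro that[of \<pi>]) (auto simp: couplings_def pmf_\<pi> h_def)
qed

lemma W1_le_coupling_cost:
  assumes "\<pi> \<in> couplings \<nu> \<mu>"
    and "\<And>x y. x \<in> V \<Longrightarrow> y \<in> V \<Longrightarrow> 0 \<le> \<rho> x y"
  shows "W1 V \<rho> \<nu> \<mu> \<le> (\<Sum>x\<in>V. \<Sum>y\<in>V. \<rho> x y * pmf \<pi> (x, y))"
  unfolding W1_def
  using assms by (intro cINF_lower bdd_belowI[where m = 0]) (auto intro!: sum_nonneg)

text \<open>
  Move mass from \<open>x\<close> to \<open>y\<close> at rate \<open>\<mu>(x) \<mu>(y) (f(x) - f(y))\<^sup>+\<close> and leave the rest where it is.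
  The mass leaving \<open>x\<close> is at most \<open>\<mu>(x) f(x)\<close> because \<open>f \<ge> 0\<close> wherever \<open>\<mu> > 0\<close> and \<open>\<mu>\<close> has
  total mass one.  The net gain of \<open>y\<close> is \<open>\<mu>(y) (\<Sum>x. \<mu>(x) (f(x) - f(y))) = \<mu>(y) (1 - f(y))\<close>, so \<open>y\<close> ends with mass
  \<open>\<mu>(y)\<close>.  Since \<open>\<rho>\<close> is symmetric, the positive parts in the cost average to one half of the
  absolute values.
\<close>
lemma W1_le_mean_oscillation:
  fixes \<nu> \<mu> :: "'v pmf" and f :: "'v \<Rightarrow> real"
  assumes fin: "finite V"
    and supp: "set_pmf \<nu> \<subseteq> V" "set_pmf \<mu> \<subseteq> V"
    and dens: "\<And>x. x \<in> V \<Longrightarrow> pmf \<nu> x = f x * pmf \<mu> x"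
    and metric: "Metric_space V \<rho>"
  shows "W1 V \<rho> \<nu> \<mu>
      \<le> 1 / 2 * (\<Sum>x\<in>V. \<Sum>y\<in>V. \<rho> x y * pmf \<mu> x * pmf \<mu> y * \<bar>f x - f y\<bar>)"
proof -
  interpret Metric_space V \<rho> by (rule metric)
  \<comment> \<open>\<open>t\<close> is the mass moved and \<open>r\<close> the mass left behind; the latter costs nothing as \<open>\<rho> x x = 0\<close>.\<close>
  define t where "t x y = pmf \<mu> x * pmf \<mu> y * max 0 (f x - f y)" for x y
  define r where "r x = pmf \<nu> x - (\<Sum>y\<in>V. t x y)" for x
  define p where "p x y = t x y + (if x = y then r x else 0)" for x y
  have mass_\<mu>: "(\<Sum>x\<in>V. pmf \<mu> x) = 1" and mass_\<nu>: "(\<Sum>x\<in>V. pmf \<nu> x) = 1"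
    using sum_pmf_eq_1[OF fin] supp by auto
  have t_nonneg: "0 \<le> t x y" for x y
    by (simp add: t_def)
  have r_nonneg: "0 \<le> r x" if x: "x \<in> V" for x
  proof -
    have "t x y \<le> pmf \<nu> x * pmf \<mu> y" if y: "y \<in> V" for y
    proof -
      have fx: "0 \<le> f x * pmf \<mu> x" and fy: "0 \<le> f y * pmf \<mu> y"
        using dens[OF x] dens[OF y] by (metis pmf_nonneg)+
      have "pmf \<mu> x * pmf \<mu> y * (f x - f y) = f x * pmf \<mu> x * pmf \<mu> y - pmf \<mu> x * (f y * pmf \<mu> y)"
        by (simp add: algebra_simps)
      also have "\<dots> \<le> f x * pmf \<mu> x * pmf \<mu> y"
        using fy by simp
      finally have "pmf \<mu> x * pmf \<mu> y * (f x - f y) \<le> pmf \<nu> x * pmf \<mu> y"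
        using dens[OF x] by simp
      then show ?thesis
        by (auto simp: t_def max_def)
    qed
    then have "(\<Sum>y\<in>V. t x y) \<le> (\<Sum>y\<in>V. pmf \<nu> x * pmf \<mu> y)"
      by (rule sum_mono)
    also have "\<dots> = pmf \<nu> x"
      by (simp add: mass_\<mu> flip: sum_distrib_left)
    finally show ?thesis
      by (simp add: r_def)
  qed
  have rows: "(\<Sum>y\<in>V. p x y) = pmf \<nu> x" if "x \<in> V" for x
    using fin that by (simp add: p_def r_def sum.distrib)
  have cols: "(\<Sum>x\<in>V. p x y) = pmf \<mu> y" if y: "y \<in> V" for y
  proof -
    have "(\<Sum>x\<in>V. t x y) - (\<Sum>x\<in>V. t y x) = (\<Sum>x\<in>V. pmf \<mu> x * pmf \<mu> y * (f x - f y))"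
      unfolding sum_subtractf[symmetric]
      by (intro sum.cong) (auto simp: t_def max_def algebra_simps)
    also have "\<dots> = (\<Sum>x\<in>V. pmf \<mu> y * pmf \<nu> x - pmf \<nu> y * pmf \<mu> x)"
      by (intro sum.cong) (auto simp: dens y algebra_simps)
    also have "\<dots> = pmf \<mu> y - pmf \<nu> y"
      by (simp add: sum_subtractf mass_\<mu> mass_\<nu> flip: sum_distrib_left)
    finally show ?thesis
      using fin y by (simp add: p_def r_def sum.distrib)
  qed
  have p_nonneg: "0 \<le> p x y" if "x \<in> V" for x y
    using t_nonneg r_nonneg[OF that] by (auto simp: p_def)
  obtain \<pi> where \<pi>: "\<pi> \<in> couplings \<nu> \<mu>" "\<And>x y. x \<in> V \<Longrightarrow> y \<in> V \<Longrightarrow> pmf \<pi> (x, y) = p x y"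
    using coupling_of_matrix[OF fin supp p_nonneg rows cols] by blast
  have "W1 V \<rho> \<nu> \<mu> \<le> (\<Sum>x\<in>V. \<Sum>y\<in>V. \<rho> x y * pmf \<pi> (x, y))"
    by (intro W1_le_coupling_cost \<pi>) simp
  also have "\<dots> = (\<Sum>x\<in>V. \<Sum>y\<in>V. \<rho> x y * t x y)"
    by (intro sum.cong) (auto simp: \<pi>(2) p_def)
  also have "\<dots> = 1 / 2 * ((\<Sum>x\<in>V. \<Sum>y\<in>V. \<rho> x y * t x y) + (\<Sum>y\<in>V. \<Sum>x\<in>V. \<rho> x y * t x y))"
    by (simp add: sum.swap[of "\<lambda>x y. \<rho> x y * t x y"])
  also have "\<dots> = 1 / 2 * (\<Sum>x\<in>V. \<Sum>y\<in>V. \<rho> x y * t x y + \<rho> y x * t y x)"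
    by (simp add: sum.distrib)
  also have "\<dots> = 1 / 2 * (\<Sum>x\<in>V. \<Sum>y\<in>V. \<rho> x y * pmf \<mu> x * pmf \<mu> y * \<bar>f x - f y\<bar>)"
    by (intro arg_cong[where f = "\<lambda>s. 1 / 2 * s"] sum.cong refl)
       (auto simp: t_def max_def commute algebra_simps)
  finally show ?thesis .
qed

section \<open>Gradients along paths\<close>
lemma abs_diff_le_sum_list_walk:
  assumes "pre_digraph.cas (with_proj G) x p y"
  shows "\<bar>f x - f y\<bar> \<le> (\<Sum>e\<leftarrow>p. \<bar>D_edge e f\<bar>)"
  using assms
proof (induction p arbitrary: x)
  case Nil
  then show ?case by (simp add: pre_digraph.cas.simps)
next
  case (Cons e p)
  then have "fst e = x" "pre_digraph.cas (with_proj G) (snd e) p y"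
    by (auto simp: pre_digraph.cas.simps)
  with Cons.IH show ?case
    by (fastforce simp: D_edge_def)
qed

text \<open>
  A path without circle repeats no edge, so the sum along the path counts each edge of the graph
  at most once, and the indicator of the path replaces its multiplicity.
\<close>
lemma (in pair_fin_digraph) abs_diff_le_sum_path:
  assumes "pre_digraph.apath (with_proj G) x p y"
  shows "\<bar>f x - f y\<bar> \<le> (\<Sum>e\<in>parcs G. indicator (set p) e * \<bar>D_edge e f\<bar>)"
proof -
  have cas: "pre_digraph.cas (with_proj G) x p y" and sub: "set p \<subseteq> parcs G"
    using assms by (auto simp: pre_digraph.apath_def pre_digraph.awalk_def)
  have "distinct p"
    using assms distinct_verts_imp_distinct[of x p y] by (auto simp: apath_def)
  have "\<bar>f x - f y\<bar> \<le> (\<Sum>e\<leftarrow>p. \<bar>D_edge e f\<bar>)"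
    using cas by (rule abs_diff_le_sum_list_walk)
  also have "\<dots> = (\<Sum>e\<in>set p. \<bar>D_edge e f\<bar>)"
    using \<open>distinct p\<close> by (simp add: sum_list_distinct_conv_sum_set)
  also have "\<dots> = (\<Sum>e\<in>parcs G. indicator (set p) e * \<bar>D_edge e f\<bar>)"
    using sub pair_finite_arcs
    by (intro sum.mono_neutral_cong_left) (auto simp: indicator_def)
  finally show ?thesis .
qed

text \<open>
  Some vertex has positive mass, and across an edge \<open>(u, v)\<close> detailed balance makes
  \<open>\<mu>(v) q(v,u) = \<mu>(u) q(u,v)\<close> positive as soon as \<open>\<mu>(u)\<close> is; connectedness carries this everywhere.
\<close>
lemma (in pair_graph) reversible_measure_pos:
  assumes conn: "Digraph_Component.connected (with_proj G)"
    and supp: "set_pmf \<mu> \<subseteq> pverts G"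
    and q_pos: "\<And>x y. (x, y) \<in> parcs G \<Longrightarrow> 0 < q x y"
    and balance: "\<And>x y. (x, y) \<in> parcs G \<Longrightarrow> pmf \<mu> x * q x y = pmf \<mu> y * q y x"
    and y: "y \<in> pverts G"
  shows "0 < pmf \<mu> y"
proof -
  obtain x where x: "x \<in> set_pmf \<mu>"
    using set_pmf_not_empty by fast
  with supp have "x \<in> pverts G" by auto
  with y conn have "x \<rightarrow>\<^sup>*\<^bsub>with_proj G\<^esub> y"
    by (simp add: connected_def strongly_connected_def reachable_mk_symmetric_eq[OF pair_sym_arcs])
  then show ?thesis
  proof (induction rule: reachable_induct)
    case base
    then show ?case using x by (simp add: pmf_positive)
  next
    case (step u v)
    then have uv: "(u, v) \<in> parcs G" by simp
    have "pmf \<mu> v \<noteq> 0"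
      using balance[OF uv] q_pos[OF uv] step by auto
    then show ?case by (simp add: pmf_nonneg less_le)
  qed
qed

section \<open>The best constant\<close>

text \<open>
  Each instance of the inequality is a closed condition on the constant, so the admissible constants
  form a closed set that is bounded below, and its infimum belongs to it.
\<close>
lemma c_I_le:
  assumes c: "0 \<le> c" "W1_inequality G q \<mu> \<rho> c"
  shows "c_I G q \<mu> \<rho> \<le> c"
proof -
  define S where "S = {c. 0 \<le> c \<and> W1_inequality G q \<mu> \<rho> c}"
  have "closed S"
    unfolding S_def W1_inequality_def
    by (intro closed_Collect_conj closed_Collect_all closed_Collect_imp open_Collect_const
        closed_Collect_le continuous_intros) simp_all
  moreover have "S \<noteq> {}" "bdd_below S"
    using c by (auto simp: S_def intro!: bdd_belowI[where m = 0])
  ultimately have "Inf S \<in> S" and "\<And>d. d \<in> S \<Longrightarrow> Inf S \<le> d"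
    by (auto intro: closed_contains_Inf cInf_lower)
  then have "c_I G q \<mu> \<rho> = Inf S"
    unfolding c_I_def S_def by (intro Least_equality) auto
  moreover have "Inf S \<le> c"
    using c \<open>\<And>d. d \<in> S \<Longrightarrow> Inf S \<le> d\<close> by (auto simp: S_def)
  ultimately show ?thesis by simp
qed

theorem theorem3p5:
  fixes G :: "'v pair_pre_digraph"
    and q :: "'v \<Rightarrow> 'v \<Rightarrow> real"
    and \<mu> :: "'v pmf"
    and \<rho> :: "'v \<Rightarrow> 'v \<Rightarrow> real"
    and M :: "'w measure"
    and \<gamma> :: "'v \<Rightarrow> 'v \<Rightarrow> 'w \<Rightarrow> ('v \<times> 'v) list"
  assumes graph: "pair_graph G" "Digraph_Component.connected (with_proj G)"
    and rates_nonneg: "\<And>x y. x \<in> pverts G \<Longrightarrow> y \<in> pverts G \<Longrightarrow> 0 \<le> q x y"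
    and rates_pos: "\<And>x y. x \<in> pverts G \<Longrightarrow> y \<in> pverts G \<Longrightarrow> 0 < q x y \<longleftrightarrow> (x, y) \<in> parcs G"
    and mu: "set_pmf \<mu> \<subseteq> pverts G"
    and detailed_balance: "\<And>x y. (x, y) \<in> parcs G \<Longrightarrow> pmf \<mu> x * q x y = pmf \<mu> y * q y x"
    and metric: "Metric_space (pverts G) \<rho>"
    and prob: "prob_space M"
    and gamma_random: "\<And>x y. x \<in> pverts G \<Longrightarrow> y \<in> pverts G \<Longrightarrow>
                         \<gamma> x y \<in> M \<rightarrow>\<^sub>M count_space UNIV"
    and gamma_path: "\<And>x y \<omega>. x \<in> pverts G \<Longrightarrow> y \<in> pverts G \<Longrightarrow> x \<noteq> y \<Longrightarrow> \<omega> \<in> space M \<Longrightarrow>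
                         pre_digraph.apath (with_proj G) x (\<gamma> x y \<omega>) y"
    and gamma_refl: "\<And>x \<omega>. x \<in> pverts G \<Longrightarrow> \<omega> \<in> space M \<Longrightarrow> \<gamma> x x \<omega> = []"
  shows "c_I G q \<mu> \<rho> \<le> kappa G q \<mu> \<rho> M \<gamma>"
proof -
  interpret pair_graph G by (rule graph(1))
  interpret prob_space M by (rule prob)
  interpret Metric_space "pverts G" \<rho> by (rule metric)
  let ?V = "pverts G" and ?E = "parcs G" and ?\<kappa> = "kappa G q \<mu> \<rho> M \<gamma>"
  \<comment> \<open>\<open>load e \<omega>\<close> is the total weight \<open>w\<close> of the pairs whose path uses \<open>e\<close>; its mean divided by \<open>Q(e)\<close>
    is the quantity maximised in \<open>\<kappa>\<close>.\<close>
  define w where "w x y = \<rho> x y * pmf \<mu> x * pmf \<mu> y" for x y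
  have w_nonneg: "0 \<le> w x y" for x y
    by (simp add: w_def)
  define load where
    "load e \<omega> = (\<Sum>x\<in>?V. \<Sum>y\<in>?V. indicator (set (\<gamma> x y \<omega>)) e * w x y)" for e \<omega>
  have load_nonneg: "0 \<le> load e \<omega>" for e \<omega>
    by (auto simp: load_def w_nonneg intro!: sum_nonneg)
  have load_integrable: "integrable M (load e)" for e
    unfolding load_def
  proof (intro Bochner_Integration.integrable_sum integrable_mult_left integrable_const_bound[where B = 1])
    fix x y assume "x \<in> ?V" "y \<in> ?V"
    then show "(\<lambda>\<omega>. indicator (set (\<gamma> x y \<omega>)) e :: real) \<in> borel_measurable M"
      by (rule measurable_compose[OF gamma_random]) simp
  qed (simp add: indicator_def)

  have Q_pos: "0 < Q_edge \<mu> q e" if "e \<in> ?E" for e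
  proof -
    obtain x y where [simp]: "e = (x, y)" by (cases e)
    have "x \<in> ?V" "y \<in> ?V" using that by (auto dest: in_arcsD1 in_arcsD2)
    moreover have "0 < q a b" if "(a, b) \<in> ?E" for a b
      using that rates_pos by (auto dest: in_arcsD1 in_arcsD2)
    ultimately show ?thesis
      using that reversible_measure_pos[OF graph(2) mu _ detailed_balance]
      by (simp add: Q_edge_def)
  qed
  have kappa_eq: "?\<kappa> = (if ?E = {} then 0 else Max ((\<lambda>e. 1 / Q_edge \<mu> q e * (\<integral>\<omega>. load e \<omega> \<partial>M)) ` ?E))"
    by (simp add: kappa_def load_def w_def mult.assoc)
  have ratio_le: "1 / Q_edge \<mu> q e * (\<integral>\<omega>. load e \<omega> \<partial>M) \<le> ?\<kappa>" if "e \<in> ?E" for e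
  proof -
    have "?E \<noteq> {}" using that by auto
    then show ?thesis
      unfolding kappa_eq using that pair_finite_arcs by simp
  qed
  have load_le: "(\<integral>\<omega>. load e \<omega> \<partial>M) \<le> ?\<kappa> * Q_edge \<mu> q e" if "e \<in> ?E" for e
    using ratio_le[OF that] Q_pos[OF that] by (simp add: field_simps)
  have kappa_nonneg: "0 \<le> ?\<kappa>"
  proof (cases "?E = {}")
    case False
    then obtain e where e: "e \<in> ?E" by auto
    have "0 \<le> (\<integral>\<omega>. load e \<omega> \<partial>M)"
      by (simp add: load_nonneg)
    then have "0 \<le> 1 / Q_edge \<mu> q e * (\<integral>\<omega>. load e \<omega> \<partial>M)"
      using Q_pos[OF e] by simp
    also have "\<dots> \<le> ?\<kappa>" by (rule ratio_le[OF e])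
    finally show ?thesis .
  qed (simp add: kappa_def)

  have oscillation_le:
    "(\<Sum>x\<in>?V. \<Sum>y\<in>?V. w x y * \<bar>f x - f y\<bar>) \<le> ?\<kappa> * (\<Sum>e\<in>?E. \<bar>D_edge e f\<bar> * Q_edge \<mu> q e)"
    (is "?L \<le> _") for f
  proof -
    have pointwise: "?L \<le> (\<Sum>e\<in>?E. load e \<omega> * \<bar>D_edge e f\<bar>)" if \<omega>: "\<omega> \<in> space M" for \<omega>
    proof -
      have "\<bar>f x - f y\<bar> \<le> (\<Sum>e\<in>?E. indicator (set (\<gamma> x y \<omega>)) e * \<bar>D_edge e f\<bar>)"
        if "x \<in> ?V" "y \<in> ?V" for x y
        using abs_diff_le_sum_path[OF gamma_path[OF that _ \<omega>]]
        by (cases "x = y") (auto intro!: sum_nonneg)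
      then have "?L \<le> (\<Sum>x\<in>?V. \<Sum>y\<in>?V.
          w x y * (\<Sum>e\<in>?E. indicator (set (\<gamma> x y \<omega>)) e * \<bar>D_edge e f\<bar>))"
        by (intro sum_mono mult_left_mono w_nonneg)
      also have "\<dots> = (\<Sum>x\<in>?V. \<Sum>y\<in>?V. \<Sum>e\<in>?E.
          indicator (set (\<gamma> x y \<omega>)) e * w x y * \<bar>D_edge e f\<bar>)"
        by (simp only: sum_distrib_left mult_ac)
      also have "\<dots> = (\<Sum>x\<in>?V. \<Sum>e\<in>?E. \<Sum>y\<in>?V.
          indicator (set (\<gamma> x y \<omega>)) e * w x y * \<bar>D_edge e f\<bar>)"
        by (intro sum.cong refl sum.swap)
      also have "\<dots> = (\<Sum>e\<in>?E. \<Sum>x\<in>?V. \<Sum>y\<in>?V.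
          indicator (set (\<gamma> x y \<omega>)) e * w x y * \<bar>D_edge e f\<bar>)"
        by (rule sum.swap)
      also have "\<dots> = (\<Sum>e\<in>?E. load e \<omega> * \<bar>D_edge e f\<bar>)"
        by (simp only: load_def sum_distrib_right)
      finally show ?thesis .
    qed
    \<comment> \<open>The oscillation is deterministic, hence equal to its own expectation.\<close>
    have "?L = (\<integral>\<omega>. ?L \<partial>M)"
      by (simp add: prob_space)
    also have "\<dots> \<le> (\<integral>\<omega>. (\<Sum>e\<in>?E. load e \<omega> * \<bar>D_edge e f\<bar>) \<partial>M)"
      by (intro integral_mono Bochner_Integration.integrable_sum integrable_mult_left
          load_integrable pointwise) auto
    also have "\<dots> = (\<Sum>e\<in>?E. (\<integral>\<omega>. load e \<omega> \<partial>M) * \<bar>D_edge e f\<bar>)"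
      by (subst Bochner_Integration.integral_sum) (auto intro!: integrable_mult_left load_integrable)
    also have "\<dots> \<le> (\<Sum>e\<in>?E. ?\<kappa> * Q_edge \<mu> q e * \<bar>D_edge e f\<bar>)"
      by (intro sum_mono mult_right_mono load_le) auto
    also have "\<dots> = ?\<kappa> * (\<Sum>e\<in>?E. \<bar>D_edge e f\<bar> * Q_edge \<mu> q e)"
      by (simp add: sum_distrib_left mult_ac)
    finally show ?thesis .
  qed

  have "W1_inequality G q \<mu> \<rho> ?\<kappa>"
    unfolding W1_inequality_def
  proof (intro allI impI)
    fix \<nu> :: "'v pmf" and f :: "'v \<Rightarrow> real"
    assume "set_pmf \<nu> \<subseteq> ?V" and "\<forall>x\<in>?V. pmf \<nu> x = f x * pmf \<mu> x"
    then have "W1 ?V \<rho> \<nu> \<mu> \<le> 1 / 2 * (\<Sum>x\<in>?V. \<Sum>y\<in>?V. w x y * \<bar>f x - f y\<bar>)"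
      unfolding w_def using mu metric by (intro W1_le_mean_oscillation pair_finite_verts) auto
    also have "\<dots> \<le> ?\<kappa> / 2 * (\<Sum>e\<in>?E. \<bar>D_edge e f\<bar> * Q_edge \<mu> q e)"
      using oscillation_le[of f] by simp
    finally show "W1 ?V \<rho> \<nu> \<mu> \<le> ?\<kappa> / 2 * (\<Sum>e\<in>?E. \<bar>D_edge e f\<bar> * Q_edge \<mu> q e)" .
  qed
  with kappa_nonneg show ?thesis
    by (rule c_I_le)
qed

end
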